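(* Define a sequence of triples by $S_1=(1,2,5)$, $S_2=(701,430,15)$ and, for every $n\ge 2$, let $S_{2n-1}$ and $S_{2n}$ be respectively the first and the second successor of $S_n$. Then every pp-solution of $7x^2+59y^2=3^m$ is equal to $S_n$ for some $n\ge 1$; that is, every pp-solution belongs to the binary tree of iterated successors generated from $S_1$ and $S_2$.
   Context: A solution of $7x^2+59y^2=3^m$ means a triple $(x,y,m)$ of non-zero integers with $m>0$ satisfying the equation. A pp-solution is a solution with $x,y>0$ and $\gcd(x,y)=1$. For non-zero integers $p,q$ define $$A(p,q)=59p^2-236pq-7q^2,\qquad B(p,q)=-118p^2-14pq+14q^2.$$ Successors: let $(q,p_0,\omega)$ be a pp-solution, so $7q^2+59p_0^2=3^\omega$ (and $3\nmid p_0q$), and let $p\in\{p_0,-p_0\}$ be such that $pq\equiv-1\pmod 3$. The first successor of $(q,p_0,\omega)$ is $(3^{-5}|A(p,q)|,\,3^{-5}|B(p,q)|,\,2\omega-5)$ and the second successor is $(|A(-p,q)|,\,|B(-p,q)|,\,2\omega+5)$. Both successors of a pp-solution are again pp-solutions. The first successor of $S_1=(1,2,5)$ is $S_1$ itself and its second successor is $S_2=(701,430,15)$. *)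

theory Defs
  imports "HOL-Number_Theory.Cong"
begin

type_synonym triple = "int \<times> int \<times> int"

text \<open>The guard \<open>m > 0\<close> makes \<open>3 ^ nat m\<close> the honest power.\<close>

definition is_solution :: "triple \<Rightarrow> bool" where
  "is_solution = (\<lambda>(x, y, m). x \<noteq> 0 \<and> y \<noteq> 0 \<and> m > 0 \<and> 7 * x\<^sup>2 + 59 * y\<^sup>2 = 3 ^ nat m)"

definition pp_solution :: "triple \<Rightarrow> bool" where
  "pp_solution = (\<lambda>(x, y, m). is_solution (x, y, m) \<and> x > 0 \<and> y > 0 \<and> gcd x y = 1)"

definition A :: "int \<Rightarrow> int \<Rightarrow> int" where
  "A p q = 59 * p\<^sup>2 - 236 * p * q - 7 * q\<^sup>2"

definition B :: "int \<Rightarrow> int \<Rightarrow> int" where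
  "B p q = - 118 * p\<^sup>2 - 14 * p * q + 14 * q\<^sup>2"

text \<open>
  The \<open>p \<in> {p0, - p0}\<close> with \<open>p * q \<equiv> -1 (mod 3)\<close>; it exists and is unique when
  \<open>3\<close> does not divide \<open>p0 * q\<close>, see \<open>signed_root_unique\<close> below.
\<close>

definition signed_root :: "int \<Rightarrow> int \<Rightarrow> int" where
  "signed_root q p0 = (if [p0 * q = - 1] (mod 3) then p0 else - p0)"

text \<open>
  The integer division by \<open>3 ^ 5\<close> is exact on pp-solutions, see \<open>first_successor_exact\<close> below.
\<close>

definition first_successor :: "triple \<Rightarrow> triple" where
  "first_successor = (\<lambda>(q, p0, \<omega>). let p = signed_root q p0 in
     (\<bar>A p q\<bar> div 3 ^ 5, \<bar>B p q\<bar> div 3 ^ 5, 2 * \<omega> - 5))"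

definition second_successor :: "triple \<Rightarrow> triple" where
  "second_successor = (\<lambda>(q, p0, \<omega>). let p = signed_root q p0 in
     (\<bar>A (- p) q\<bar>, \<bar>B (- p) q\<bar>, 2 * \<omega> + 5))"

text \<open>
  Indexed from \<open>1\<close>; the value at \<open>0\<close> is irrelevant. The defining recursion of the sequence
  is \<open>S_odd\<close>, \<open>S_even\<close> below.
\<close>

fun S :: "nat \<Rightarrow> triple" where
  "S n = (if n \<le> 1 then (1, 2, 5)
          else if n = 2 then (701, 430, 15)
          else if odd n then first_successor (S ((n + 1) div 2))
          else second_successor (S (n div 2)))"

declare S.simps [simp del]

inductive_set successor_tree :: "triple set" where
  root1: "S 1 \<in> successor_tree"
| root2: "S 2 \<in> successor_tree"
| first: "t \<in> successor_tree \<Longrightarrow> first_successor t \<in> successor_tree"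
| second: "t \<in> successor_tree \<Longrightarrow> second_successor t \<in> successor_tree"

lemma S_1: "S 1 = (1, 2, 5)"
  by (simp add: S.simps)

lemma S_2: "S 2 = (701, 430, 15)"
  by (simp add: S.simps)

lemma S_odd: "S (2 * n - 1) = first_successor (S n)" if "n \<ge> 2"
proof -
  have "2 * n - 1 > 2" "odd (2 * n - 1)" "(2 * n - 1 + 1) div 2 = n"
    using that by auto
  then show ?thesis by (subst S.simps) auto
qed

lemma S_even: "S (2 * n) = second_successor (S n)" if "n \<ge> 2"
  using that by (subst S.simps) auto

lemma successors_S_1:
  "first_successor (S 1) = S 1" "second_successor (S 1) = S 2"
proof -
  have "signed_root 1 2 = 2"
    by (simp add: signed_root_def cong_def)
  then show "first_successor (S 1) = S 1" "second_successor (S 1) = S 2"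
    unfolding S_1 S_2 by (simp_all add: first_successor_def second_successor_def A_def B_def)
qed

lemma mod_3_cases: "(x::int) mod 3 = 0 \<or> x mod 3 = 1 \<or> x mod 3 = 2"
  by presburger

lemma signed_root_unique:
  assumes "\<not> 3 dvd p0 * q"
  shows "p \<in> {p0, - p0} \<and> [p * q = - 1] (mod 3) \<longleftrightarrow> p = signed_root q p0"
proof -
  have "[- x = - 1] (mod 3) \<longleftrightarrow> \<not> [x = - 1] (mod 3)" if "\<not> 3 dvd x" for x :: int
    using that unfolding cong_def by presburger
  from this[OF assms] show ?thesis
    unfolding signed_root_def by auto
qed

lemma pp_solution_not_dvd:
  assumes "pp_solution (q, p0, \<omega>)"
  shows "\<not> 3 dvd p0 * q"
proof
  assume "3 dvd p0 * q"
  have p3: "prime (3::int)" by simp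
  from assms have eq: "7 * q\<^sup>2 + 59 * p0\<^sup>2 = 3 ^ nat \<omega>" and g: "gcd q p0 = 1" and "\<omega> > 0"
    by (auto simp: pp_solution_def is_solution_def)
  have d: "3 dvd 7 * q\<^sup>2 + 59 * p0\<^sup>2"
    unfolding eq using \<open>\<omega> > 0\<close> by (intro dvd_power) auto
  have n: "\<not> (3::int) dvd 7" "\<not> (3::int) dvd 59" by presburger+
  have sq: "3 dvd x" if "3 dvd c * x\<^sup>2" "\<not> 3 dvd c" for c x :: int
    using that prime_dvd_multD[OF p3 that(1)] prime_dvd_power[OF p3, of x 2] by blast
  have qs: "3 dvd c * x\<^sup>2" if "3 dvd x" for c x :: int
    unfolding power2_eq_square by (intro dvd_mult that)
  have "3 dvd q \<longleftrightarrow> 3 dvd p0"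
  proof
    assume "3 dvd q"
    then have "3 dvd 7 * q\<^sup>2" by (rule qs)
    with d have "3 dvd 59 * p0\<^sup>2" by (metis dvd_add_right_iff)
    then show "3 dvd p0" using n(2) by (rule sq)
  next
    assume "3 dvd p0"
    then have "3 dvd 59 * p0\<^sup>2" by (rule qs)
    with d have "3 dvd 7 * q\<^sup>2" by (metis dvd_add_left_iff)
    then show "3 dvd q" using n(1) by (rule sq)
  qed
  with \<open>3 dvd p0 * q\<close> have "3 dvd q" "3 dvd p0" using prime_dvd_multD[OF p3] by blast+
  then have "3 dvd gcd q p0" by (rule gcd_greatest)
  then show False unfolding g by presburger
qed

lemma first_successor_exact:
  assumes "pp_solution (q, p0, \<omega>)"
  shows "3 ^ 5 dvd A (signed_root q p0) q" "3 ^ 5 dvd B (signed_root q p0) q"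
proof -
  define p where "p = signed_root q p0"
  from assms have eq: "7 * q\<^sup>2 + 59 * p0\<^sup>2 = 3 ^ nat \<omega>" and "q > 0" "p0 > 0"
    by (auto simp: pp_solution_def is_solution_def)
  have "p\<^sup>2 = p0\<^sup>2" by (simp add: p_def signed_root_def)
  have pq: "[p * q = - 1] (mod 3)"
    using signed_root_unique[OF pp_solution_not_dvd[OF assms], of p] by (simp add: p_def)
  have "nat \<omega> \<ge> 5"
  proof (rule ccontr)
    assume "\<not> nat \<omega> \<ge> 5"
    then have w: "nat \<omega> \<in> {0, 1, 2, 3, 4}" by auto
    then have "(3::int) ^ nat \<omega> \<le> 81" by auto
    have "q\<^sup>2 \<ge> q" "p0\<^sup>2 \<ge> p0" using \<open>q > 0\<close> \<open>p0 > 0\<close> by (auto simp: power2_eq_square)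
    with eq \<open>3 ^ nat \<omega> \<le> 81\<close> have "p0 \<le> 1" "q \<le> 3" using \<open>q > 0\<close> \<open>p0 > 0\<close> by linarith+
    then have "p0 = 1" "q = 1 \<or> q = 2 \<or> q = 3" using \<open>q > 0\<close> \<open>p0 > 0\<close> by linarith+
    with eq w show False by auto
  qed
  then have "(3::int) ^ 5 dvd 7 * q\<^sup>2 + 59 * p\<^sup>2"
    unfolding \<open>p\<^sup>2 = p0\<^sup>2\<close> eq by (rule le_imp_power_dvd)
  then obtain k where k: "7 * q\<^sup>2 + 59 * p\<^sup>2 = 3 ^ 5 * k" ..
  have "59 * ((p - 2 * q) * (p + 2 * q)) = 3 ^ 5 * (k - q\<^sup>2)"
    using k by (simp add: algebra_simps power2_eq_square)
  then have "(3::int) ^ 5 dvd 59 * ((p - 2 * q) * (p + 2 * q))" by simp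
  moreover have "coprime ((3::int) ^ 5) 59"
    by (simp add: coprime_iff_gcd_eq_1 gcd_non_0_int)
  ultimately have d: "(3::int) ^ 5 dvd (p - 2 * q) * (p + 2 * q)"
    by (simp only: coprime_dvd_mult_right_iff)
  have "\<not> 3 dvd p + 2 * q"
  proof
    assume "3 dvd p + 2 * q"
    then obtain j where "p + 2 * q = 3 * j" ..
    then have j: "p = 3 * j - 2 * q" by simp
    have e: "p * q = 3 * (j * q - q * q) + q * q" unfolding j by (simp add: algebra_simps)
    have red: "b mod 3 = 2" if "(3 * a + b) mod 3 = - 1 mod 3" for a b :: int
      using that by presburger
    have "q * q mod 3 = 2"
      using pq unfolding e cong_def by (rule red)
    moreover have "q * q mod 3 = (q mod 3) * (q mod 3) mod 3" by (rule mod_mult_eq [symmetric])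
    ultimately show False using mod_3_cases[of q] by auto
  qed
  moreover have "prime (3::int)" by simp
  ultimately have "coprime 3 (p + 2 * q)"
    by (intro prime_imp_coprime)
  then have "coprime ((3::int) ^ 5) (p + 2 * q)"
    by (subst coprime_power_left_iff) simp
  with d have "(3::int) ^ 5 dvd p - 2 * q"
    by (simp only: coprime_dvd_mult_left_iff)
  then obtain l where "p - 2 * q = 3 ^ 5 * l" ..
  then have l: "p = 3 ^ 5 * l + 2 * q" by simp
  have "A p q = 3 ^ 5 * (59 * 3 ^ 5 * l\<^sup>2 - q\<^sup>2)"
    unfolding A_def l by (simp add: algebra_simps power2_eq_square)
  then show "3 ^ 5 dvd A (signed_root q p0) q" unfolding p_def by simp
  have "B p q = 3 ^ 5 * (- 118 * 3 ^ 5 * l\<^sup>2 - 486 * l * q - 2 * q\<^sup>2)"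
    unfolding B_def l by (simp add: algebra_simps power2_eq_square)
  then show "3 ^ 5 dvd B (signed_root q p0) q" unfolding p_def by simp
qed

end

theory Submission
  imports Defs
begin

text \<open>
  The idea is to show that there is exactly one pp-solution for each exponent \<open>5, 15, 25, \<dots>\<close>
  and none for any other, and that \<open>S n\<close> is the one with exponent \<open>10 n - 5\<close>.

  Write a solution as \<open>\<alpha> = x \<surd>7 + y \<surd>-59\<close>, of norm \<open>3\<^sup>m\<close>, and let
  \<open>\<beta> = \<surd>7 + 2 \<surd>-59\<close> be the element of norm \<open>3\<^sup>5\<close> that belongs to \<open>S 1\<close>. The product of two such
  elements lies in the ring generated by \<open>\<surd>-413\<close>, whose norm form is \<open>u\<^sup>2 + 413 v\<^sup>2\<close>.

  \<^item> Uniqueness (\<open>pp_solution_unique\<close>): for two primitive elements of norm \<open>3\<^sup>m\<close>, one of the products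
    of the first with the second or its conjugate is divisible by \<open>3\<^sup>m\<close>. The quotient has
    norm \<open>1\<close>, so it is \<open>\<plusminus>1\<close>, and the elements agree up to signs.
  \<^item> The exponent (\<open>pp_solution_exponent\<close>): for the same reason every primitive element of norm
    divisible by \<open>3\<^sup>5\<close> can be divided by \<open>\<beta>\<close> or its conjugate, and the quotient is
    primitive again. This alternates between the two forms and lowers the exponent by \<open>5\<close>
    each time. As \<open>u\<^sup>2 + 413 v\<^sup>2\<close> has no primitive representation of \<open>3\<^sup>k\<close> for
    \<open>0 < k < 10\<close>, the descent ends at the exponent \<open>0\<close> of that form, so \<open>m \<equiv> 5 (mod 10)\<close>.
    In other words, the ideal class of a prime above \<open>3\<close> has order exactly \<open>10\<close>.
  \<^item> The tree (\<open>S_pp_solution\<close>): up to sign, a successor is \<open>\<alpha>\<^sup>2\<close> times the conjugate of \<open>\<beta>\<close>, divided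
    by \<open>3\<^sup>5\<close> for one choice of the sign of \<open>y\<close>. It is again a pp-solution, of exponent
    \<open>2 m \<mp> 5\<close>, and \<open>2 (10 n - 5) \<mp> 5\<close> is \<open>10 (2 n - 1) - 5\<close> or \<open>10 (2 n) - 5\<close>.
\<close>

section \<open>Divisibility by powers of three\<close>

lemma coprime_three_power:
  fixes c :: int
  assumes "\<not> 3 dvd c"
  shows "coprime (3 ^ n) c"
  using prime_imp_coprime[of "3::int" c] assms by (subst coprime_power_left_iff) auto

text \<open>
  A common factor \<open>3\<close> of the two factors would divide their sum \<open>2 a\<close>, so the whole power goes into
  one of them. This is the elementary form of choosing between an element and its conjugate.
\<close>

lemma three_power_dvd_diff_or_sum:
  fixes a b :: int
  assumes "3 ^ n dvd (a - b) * (a + b)" and "\<not> 3 dvd a"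
  shows "3 ^ n dvd a - b \<or> 3 ^ n dvd a + b"
proof -
  have "\<not> 3 dvd a - b \<or> \<not> 3 dvd a + b"
    using assms(2) by presburger
  then have "coprime (3 ^ n) (a - b) \<or> coprime (3 ^ n) (a + b)"
    using coprime_three_power by blast
  then show ?thesis
    using assms(1) by (auto simp: coprime_dvd_mult_left_iff coprime_dvd_mult_right_iff)
qed

lemma three_dvd_form_imp_iff:
  fixes a b :: int
  assumes "3 dvd 7 * a\<^sup>2 + 59 * b\<^sup>2"
  shows "3 dvd a \<longleftrightarrow> 3 dvd b"
proof -
  have "7 * a\<^sup>2 + 59 * b\<^sup>2 = (a - b) * (a + b) + 3 * (2 * a\<^sup>2 + 20 * b\<^sup>2)"
    by (simp add: algebra_simps power2_eq_square)
  with assms have "3 dvd (a - b) * (a + b)"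
    by (simp add: dvd_add_left_iff)
  moreover have "prime (3::int)" by simp
  ultimately have "3 dvd a - b \<or> 3 dvd a + b"
    by (metis prime_dvd_multD)
  then show ?thesis by presburger
qed

section \<open>Pp-solutions and their uniqueness\<close>

text \<open>
  A common divisor of \<open>a\<close> and \<open>b\<close> divides a power of \<open>3\<close>, so primitivity only has to be tested at
  the prime \<open>3\<close>; the same test excludes \<open>a = 0\<close> and \<open>b = 0\<close>.
\<close>

lemma pp_solutionI:
  fixes a b :: int
  assumes eq: "7 * a\<^sup>2 + 59 * b\<^sup>2 = 3 ^ nat m" and "m > 0" and a: "\<not> 3 dvd a"
  shows "pp_solution (\<bar>a\<bar>, \<bar>b\<bar>, m)"
proof -
  have "3 dvd 7 * a\<^sup>2 + 59 * b\<^sup>2"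
    unfolding eq using \<open>m > 0\<close> by (intro dvd_power) auto
  then have b: "\<not> 3 dvd b" using three_dvd_form_imp_iff a by blast
  have "gcd a b dvd 3 ^ nat m"
    unfolding eq[symmetric] power2_eq_square by (intro dvd_add dvd_mult) auto
  moreover have "coprime (3 ^ nat m) a"
    using a by (rule coprime_three_power)
  ultimately have "gcd a b = 1"
    by (metis coprime_common_divisor gcd_dvd1 is_unit_gcd coprime_iff_gcd_eq_1)
  with a b eq \<open>m > 0\<close> show ?thesis
    by (auto simp: pp_solution_def is_solution_def)
qed

lemma pp_solutionD:
  assumes "pp_solution (x, y, m)"
  shows "x > 0" "y > 0" "m > 0" "coprime x y" "7 * x\<^sup>2 + 59 * y\<^sup>2 = 3 ^ nat m"
    "\<not> 3 dvd x" "\<not> 3 dvd y"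
  using assms pp_solution_not_dvd[OF assms]
  by (auto simp: pp_solution_def is_solution_def coprime_iff_gcd_eq_1)

text \<open>
  For one choice of sign, \<open>N = 3\<^sup>m\<close> divides \<open>y x' \<mp> x y'\<close>. This is the imaginary part of a product
  of norm \<open>N\<^sup>2\<close>, and its square enters that norm with the coefficient \<open>413 > 1\<close>. Hence it vanishes
  and the fractions \<open>x / y\<close> and \<open>x' / y'\<close>, in lowest terms, coincide.
\<close>

lemma pp_solution_unique:
  assumes s: "pp_solution (x, y, m)" and t: "pp_solution (x', y', m)"
  shows "x = x' \<and> y = y'"
proof -
  note X = pp_solutionD[OF s] and X' = pp_solutionD[OF t]
  define N :: int where "N = 3 ^ nat m"
  have N: "7 * x\<^sup>2 + 59 * y\<^sup>2 = N" "7 * x'\<^sup>2 + 59 * y'\<^sup>2 = N" "N > 0"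
    using X X' by (auto simp: N_def)
  have "59 * ((y * x' - x * y') * (y * x' + x * y'))
      = x'\<^sup>2 * (7 * x\<^sup>2 + 59 * y\<^sup>2) - x\<^sup>2 * (7 * x'\<^sup>2 + 59 * y'\<^sup>2)"
    by (simp add: algebra_simps power2_eq_square)
  also have "\<dots> = N * (x'\<^sup>2 - x\<^sup>2)"
    unfolding N by (simp add: algebra_simps)
  finally have "N dvd 59 * ((y * x' - x * y') * (y * x' + x * y'))" by simp
  moreover have "coprime N 59" unfolding N_def by (rule coprime_three_power) presburger
  ultimately have "N dvd (y * x' - x * y') * (y * x' + x * y')"
    by (simp only: coprime_dvd_mult_right_iff)
  moreover have "\<not> 3 dvd y * x'"
    using X X' prime_dvd_multD[of "3::int" y x'] by auto
  ultimately have "N dvd y * x' - x * y' \<or> N dvd y * x' + x * y'"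
    unfolding N_def by (rule three_power_dvd_diff_or_sum)
  then obtain s v where s: "s = 1 \<or> s = - 1" and v: "y * x' - s * (x * y') = N * v"
    by (metis dvdE mult_1 mult_minus1 diff_minus_eq_add)
  have "(7 * x * x' + s * 59 * y * y')\<^sup>2 + 413 * (y * x' - s * (x * y'))\<^sup>2
      = (7 * x\<^sup>2 + 59 * y\<^sup>2) * (7 * x'\<^sup>2 + 59 * y'\<^sup>2)"
    using s by (auto simp: algebra_simps power2_eq_square)
  then have "413 * (N * v)\<^sup>2 \<le> N\<^sup>2"
    unfolding v N by (metis le_add_same_cancel2 zero_le_power2 power2_eq_square)
  then have "N\<^sup>2 * (413 * v\<^sup>2) \<le> N\<^sup>2 * 1"
    by (simp add: power_mult_distrib algebra_simps)
  then have "413 * v\<^sup>2 \<le> 1"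
    using \<open>N > 0\<close> by (subst (asm) mult_le_cancel_left_pos) auto
  then have "v\<^sup>2 = 0" using zero_le_power2[of v] by linarith
  with v have e: "y * x' = s * (x * y')" by simp
  have "y * x' > 0" "x * y' > 0" using X X' by auto
  with s e have e: "y * x' = x * y'" by auto
  then have "x dvd x'" "x' dvd x"
    using X(4) X'(4) by (metis coprime_dvd_mult_right_iff dvd_triv_left,
                         metis coprime_dvd_mult_left_iff dvd_triv_right)
  then have "x = x'" using X(1) X'(1) by (simp add: zdvd_antisym_nonneg)
  with e X(1) show ?thesis by simp
qed

section \<open>Descent of the exponent\<close>

text \<open>
  The quotient of \<open>x \<surd>7 + y \<surd>-59\<close> by \<open>\<beta> = \<surd>7 + 2 \<surd>-59\<close> is
  \<open>((7 x + 118 y) + (y - 2 x) \<surd>-413) / 3\<^sup>5\<close>. It is integral for one of the two signs of \<open>y\<close>,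
  because \<open>y\<^sup>2 \<equiv> 4 x\<^sup>2 (mod 3\<^sup>5)\<close>. Primitivity is kept because \<open>x = u - 118 v\<close>.
\<close>

lemma divide_by_S_1:
  fixes x y :: int
  assumes eq: "7 * x\<^sup>2 + 59 * y\<^sup>2 = 3 ^ (k + 5)" and x: "\<not> 3 dvd x"
  shows "\<exists>u v. u\<^sup>2 + 413 * v\<^sup>2 = (3::int) ^ k \<and> \<not> (3 dvd u \<and> 3 dvd v)"
proof -
  have "59 * ((2 * x - y) * (2 * x + y)) = 3 ^ 5 * (x\<^sup>2 - 3 ^ k)"
    using eq by (simp add: algebra_simps power2_eq_square power_add)
  then have "(3::int) ^ 5 dvd 59 * ((2 * x - y) * (2 * x + y))" by simp
  moreover have "coprime ((3::int) ^ 5) 59"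
    by (rule coprime_three_power) presburger
  ultimately have "3 ^ 5 dvd (2 * x - y) * (2 * x + y)"
    by (simp only: coprime_dvd_mult_right_iff)
  moreover have "\<not> 3 dvd 2 * x" using x by presburger
  ultimately have "3 ^ 5 dvd 2 * x - y \<or> 3 ^ 5 dvd 2 * x + y"
    by (rule three_power_dvd_diff_or_sum)
  then obtain s w where "s = 1 \<or> s = - 1" and "2 * x - s * y = 3 ^ 5 * w"
    by (metis dvdE mult_1 mult_minus1 diff_minus_eq_add)
  then obtain v where y: "s * y = 2 * x + 243 * v" and s: "s = 1 \<or> s = - 1"
    by (intro that[of "- w"]) auto
  define u where "u = x + 118 * v"
  have "y\<^sup>2 = (2 * x + 243 * v)\<^sup>2"
    unfolding y[symmetric] using s by auto
  then have "243 * (u\<^sup>2 + 413 * v\<^sup>2) = 7 * x\<^sup>2 + 59 * y\<^sup>2"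
    unfolding u_def by (simp add: algebra_simps power2_eq_square)
  with eq have "u\<^sup>2 + 413 * v\<^sup>2 = 3 ^ k" by (simp add: power_add)
  moreover have "\<not> (3 dvd u \<and> 3 dvd v)" unfolding u_def using x
    by (metis dvd_add_left_iff dvd_mult)
  ultimately show ?thesis by blast
qed

text \<open>
  Division by \<open>\<beta>\<close> leads back to the first form: the quotient of \<open>u + v \<surd>-413\<close> is
  \<open>((u + 118 v) \<surd>7 + (7 v - 2 u) \<surd>-59) / 3\<^sup>5\<close>, integral for one of the signs of \<open>v\<close>. The
  condition \<open>k > 0\<close> makes \<open>3\<close> divide the value of the new form, so that a factor \<open>3\<close> of \<open>x\<close>
  would also divide the other coordinate and hence \<open>u\<close>.
\<close>

lemma divide_by_S_1_principal:
  fixes u v :: int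
  assumes eq: "u\<^sup>2 + 413 * v\<^sup>2 = 3 ^ (k + 5)" and "k > 0" and uv: "\<not> (3 dvd u \<and> 3 dvd v)"
  shows "\<exists>x y. 7 * x\<^sup>2 + 59 * y\<^sup>2 = (3::int) ^ k \<and> \<not> 3 dvd x"
proof -
  have p3: "prime (3::int)" by simp
  have e: "(2 * u - 7 * v) * (2 * u + 7 * v) = 3 ^ 5 * (4 * 3 ^ k - 7 * v\<^sup>2)"
    using eq by (simp add: algebra_simps power2_eq_square power_add)
  have u: "\<not> 3 dvd u"
  proof
    assume "3 dvd u"
    moreover have "3 dvd (2 * u - 7 * v) * (2 * u + 7 * v)" unfolding e by simp
    then have "3 dvd 2 * u - 7 * v \<or> 3 dvd 2 * u + 7 * v"
      using prime_dvd_multD[OF p3] by blast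
    ultimately show False using uv by presburger
  qed
  have "3 ^ 5 dvd (2 * u - 7 * v) * (2 * u + 7 * v)" unfolding e by simp
  moreover have "\<not> 3 dvd 2 * u" using u by presburger
  ultimately have "3 ^ 5 dvd 2 * u - 7 * v \<or> 3 ^ 5 dvd 2 * u + 7 * v"
    by (rule three_power_dvd_diff_or_sum)
  then obtain w where "w = v \<or> w = - v" and "3 ^ 5 dvd 2 * u - 7 * w"
    by (metis mult_minus_right diff_minus_eq_add)
  then obtain z where w: "w\<^sup>2 = v\<^sup>2" and z: "2 * u - 7 * w = 243 * z"
    by (auto simp: dvd_def)
  \<comment> \<open>\<open>x\<close> is the first coordinate \<open>(u + 118 w) / 3\<^sup>5\<close> of the quotient\<close>
  then obtain x where x: "z + w = 2 * x"
    by (metis evenE odd_add even_mult_iff even_diff odd_numeral even_numeral)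
  have w': "w = 2 * x - z" using x by simp
  have u': "u = 7 * x + 118 * z" using z unfolding w' by simp
  have "243 * (7 * x\<^sup>2 + 59 * z\<^sup>2) = u\<^sup>2 + 413 * v\<^sup>2"
    unfolding w[symmetric] unfolding u' w' by (simp add: algebra_simps power2_eq_square)
  with eq have q: "7 * x\<^sup>2 + 59 * z\<^sup>2 = 3 ^ k" by (simp add: power_add)
  have "3 dvd 7 * x\<^sup>2 + 59 * z\<^sup>2"
    unfolding q using \<open>k > 0\<close> by (intro dvd_power) auto
  then have "3 dvd x \<longleftrightarrow> 3 dvd z" by (rule three_dvd_form_imp_iff)
  then have "\<not> 3 dvd x" using u unfolding u' by (metis dvd_add dvd_mult)
  with q show ?thesis by blast
qed

lemma not_square_between:
  fixes u a n :: int
  assumes "0 \<le> a" "a\<^sup>2 < n" "n < (a + 1)\<^sup>2"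
  shows "u\<^sup>2 \<noteq> n"
proof
  assume "u\<^sup>2 = n"
  then have "a < \<bar>u\<bar>" "\<bar>u\<bar> < a + 1"
    using assms power_less_imp_less_base[of a 2 "\<bar>u\<bar>"] power_less_imp_less_base[of "\<bar>u\<bar>" 2 "a + 1"]
    by simp_all
  then show False by linarith
qed

text \<open>
  An odd \<open>k\<close> is impossible modulo \<open>4\<close>, since \<open>3\<^sup>k \<equiv> 3\<close> is not a sum of two squares there. For
  \<open>k = 2\<close> and \<open>k = 4\<close> the size forces \<open>v = 0\<close>, which primitivity excludes. What remains is
  \<open>3\<^sup>6 - 413 = 316\<close> and \<open>3\<^sup>8 - 413 v\<^sup>2 = 6148, 4909, 2844\<close> for \<open>v = 1, 2, 3\<close>, none of them
  a square.
\<close>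

lemma principal_form_small_exponent:
  fixes u v :: int
  assumes eq: "u\<^sup>2 + 413 * v\<^sup>2 = 3 ^ k" and "k < 10" and uv: "\<not> (3 dvd u \<and> 3 dvd v)"
  shows "k = 0"
proof (rule ccontr)
  assume "k \<noteq> 0"
  have "even k"
  proof (rule ccontr)
    assume "odd k"
    then obtain j where "k = 2 * j + 1" by (elim oddE)
    then have "(3::int) ^ k = 3 * 9 ^ j" by (simp add: power_mult)
    moreover have "(9::int) ^ j mod 4 = 1"
      by (induction j) (auto simp: mod_mult_right_eq[symmetric] simp del: mod_mult_right_eq)
    ultimately have "(3::int) ^ k mod 4 = 3" by presburger
    moreover have sq: "z\<^sup>2 mod 4 = 0 \<or> z\<^sup>2 mod 4 = 1" for z :: int
    proof -
      have "z mod 4 = 0 \<or> z mod 4 = 1 \<or> z mod 4 = 2 \<or> z mod 4 = 3" by presburger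
      then show ?thesis by (auto simp: power_mod[of z 4 2, symmetric])
    qed
    moreover have "(u\<^sup>2 + v\<^sup>2 + 4 * (103 * v\<^sup>2)) mod 4 = (u\<^sup>2 + v\<^sup>2) mod 4"
      by (rule mod_mult_self2)
    then have "(u\<^sup>2 + 413 * v\<^sup>2) mod 4 = (u\<^sup>2 + v\<^sup>2) mod 4"
      by (simp add: add.commute)
    moreover have "(a + b) mod 4 \<noteq> 3"
      if "a mod 4 = 0 \<or> a mod 4 = 1" "b mod 4 = 0 \<or> b mod 4 = 1" for a b :: int
      using that by presburger
    ultimately show False using eq sq[of u] sq[of v] by metis
  qed
  with \<open>k < 10\<close> \<open>k \<noteq> 0\<close> have k: "k = 2 \<or> k = 4 \<or> k = 6 \<or> k = 8"
    by presburger
  then have "(3::int) ^ k \<le> 6561" by auto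
  with eq have "v\<^sup>2 < 16" using zero_le_power2[of u] by linarith
  then have "\<bar>v\<bar> < 4" using power_less_imp_less_base[of "\<bar>v\<bar>" 2 4] by simp
  then have "v = 0 \<or> v = 1 \<or> v = - 1 \<or> v = 2 \<or> v = - 2 \<or> v = 3 \<or> v = - 3" by linarith
  then have v: "v = 0 \<or> v\<^sup>2 = 1 \<or> v\<^sup>2 = 4 \<or> v\<^sup>2 = 9"
    by auto
  have "v \<noteq> 0"
  proof
    assume "v = 0"
    with eq uv have "u\<^sup>2 = 3 ^ k" "\<not> 3 dvd u" by auto
    then show False
      using \<open>k \<noteq> 0\<close> prime_dvd_power[of "3::int" u 2] dvd_power[of k "3::int"] by simp
  qed
  moreover have "u\<^sup>2 \<noteq> 316" by (rule not_square_between[of 17]) auto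
  moreover have "u\<^sup>2 \<noteq> 6148" by (rule not_square_between[of 78]) auto
  moreover have "u\<^sup>2 \<noteq> 4909" by (rule not_square_between[of 70]) auto
  moreover have "u\<^sup>2 \<noteq> 2844" by (rule not_square_between[of 53]) auto
  moreover have "c + u\<^sup>2 \<noteq> 0" if "c > 0" for c
    using that zero_le_power2[of u] by linarith
  ultimately show False using k v eq by auto
qed

lemma principal_form_exponent:
  fixes u v :: int
  assumes "u\<^sup>2 + 413 * v\<^sup>2 = 3 ^ k" and "\<not> (3 dvd u \<and> 3 dvd v)"
  shows "10 dvd k"
  using assms
proof (induction k arbitrary: u v rule: less_induct)
  case (less k)
  show ?case
  proof (cases "k < 10")
    case True
    then show ?thesis using principal_form_small_exponent[OF less.prems(1) _ less.prems(2)] by simp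
  next
    case False
    then obtain j where k: "k = (j + 5) + 5"
      by (metis add.assoc le_Suc_ex not_less numeral_Bit0 add.commute)
    obtain x y :: int where "7 * x\<^sup>2 + 59 * y\<^sup>2 = 3 ^ (j + 5)" "\<not> 3 dvd x"
      using divide_by_S_1_principal[OF less.prems(1)[unfolded k] _ less.prems(2)] by auto
    then obtain u' v' :: int where "u'\<^sup>2 + 413 * v'\<^sup>2 = 3 ^ j" "\<not> (3 dvd u' \<and> 3 dvd v')"
      using divide_by_S_1 by blast
    then have "10 dvd j" using less.IH[of j] k by simp
    then show ?thesis unfolding k by presburger
  qed
qed

lemma pp_solution_exponent_ge_5:
  assumes "pp_solution (x, y, m)"
  shows "nat m \<ge> 5"
proof (rule ccontr)
  note X = pp_solutionD[OF assms]
  assume "\<not> nat m \<ge> 5"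
  then have w: "nat m \<in> {0, 1, 2, 3, 4}" by auto
  then have "(3::int) ^ nat m \<le> 81" by auto
  moreover have "x\<^sup>2 \<ge> x" "y\<^sup>2 \<ge> y" using X by (auto simp: power2_eq_square)
  ultimately have "y \<le> 1" "x \<le> 3" using X by linarith+
  then have "y = 1" "x = 1 \<or> x = 2 \<or> x = 3" using X by linarith+
  with X w show False by auto
qed

lemma pp_solution_exponent:
  assumes "pp_solution (x, y, m)"
  obtains n :: nat where "n \<ge> 1" "m = 10 * int n - 5"
proof -
  note X = pp_solutionD[OF assms]
  obtain k where k: "nat m = k + 5"
    using pp_solution_exponent_ge_5[OF assms] by (metis le_Suc_ex add.commute)
  have "10 dvd k"
    using divide_by_S_1[OF X(5)[unfolded k] X(6)] principal_form_exponent by blast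
  then obtain j where "k = 10 * j" ..
  with k X(3) have "m = 10 * int (j + 1) - 5" by simp
  then show ?thesis using that[of "j + 1"] by simp
qed

section \<open>Successors and the sequence\<close>

text \<open>
  \<open>A p q\<close> and \<open>B p q\<close> are, up to a common sign, the coordinates of
  \<open>(q \<surd>7 + p \<surd>-59)\<^sup>2 (\<surd>7 - 2 \<surd>-59)\<close>, so the identity is the multiplicativity of the norm.
\<close>

lemma A_B_norm: "7 * (A p q)\<^sup>2 + 59 * (B p q)\<^sup>2 = 3 ^ 5 * (7 * q\<^sup>2 + 59 * p\<^sup>2)\<^sup>2"
  unfolding A_def B_def by (simp add: algebra_simps power2_eq_square)

lemma signed_rootD:
  assumes "pp_solution (q, p0, w)"
  shows "(signed_root q p0)\<^sup>2 = p0\<^sup>2" "(signed_root q p0 * q) mod 3 = 2"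
    "\<not> 3 dvd signed_root q p0"
  using signed_root_unique[OF pp_solution_not_dvd[OF assms], of "signed_root q p0"]
    pp_solutionD(7)[OF assms]
  by (auto simp: cong_def signed_root_def split: if_splits)

text \<open>
  That \<open>3\<^sup>5\<close> divides \<open>A p q\<close> means \<open>p \<equiv> 2 q (mod 3\<^sup>5)\<close>, and substituting this into \<open>A\<close> gives
  \<open>A p q / 3\<^sup>5 \<equiv> - q\<^sup>2 (mod 3)\<close>: exactly the factor \<open>3\<^sup>5\<close> is removed, and primitivity survives.
\<close>

lemma pp_solution_first_successor:
  assumes "pp_solution (q, p0, w)"
  shows "pp_solution (first_successor (q, p0, w))" "snd (snd (first_successor (q, p0, w))) = 2 * w - 5"
proof -
  note X = pp_solutionD[OF assms]
  define p where "p = signed_root q p0"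
  have p: "p\<^sup>2 = p0\<^sup>2" "\<not> 3 dvd p"
    using signed_rootD[OF assms] by (simp_all add: p_def)
  obtain a b where a: "A p q = 3 ^ 5 * a" and b: "B p q = 3 ^ 5 * b"
    using first_successor_exact[OF assms] unfolding p_def dvd_def by blast
  have w: "nat w \<ge> 5" by (rule pp_solution_exponent_ge_5[OF assms])
  have eq: "7 * q\<^sup>2 + 59 * p\<^sup>2 = 3 ^ nat w" using X p by simp
  have "3 ^ 5 * (3 ^ 5 * (7 * a\<^sup>2 + 59 * b\<^sup>2)) = (3 ^ 5 * (3 ^ nat w)\<^sup>2 :: int)"
    using A_B_norm[of p q] unfolding a b eq by (simp add: algebra_simps power2_eq_square)
  moreover have "(3 ^ nat w)\<^sup>2 = (3 ^ 5 * 3 ^ nat (2 * w - 5) :: int)"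
    using w by (subst power_add[symmetric], subst power_mult[symmetric]) (simp add: nat_diff_distrib nat_mult_distrib)
  ultimately have ab: "7 * a\<^sup>2 + 59 * b\<^sup>2 = 3 ^ nat (2 * w - 5)" by simp
  \<comment> \<open>adding the norm, a multiple of \<open>3\<^sup>5\<close>, to \<open>A p q\<close> exposes the factor \<open>p - 2 q\<close>\<close>
  have "3 ^ 5 dvd A p q + 3 ^ nat w"
    using le_imp_power_dvd[OF w, of "3::int"] unfolding a by (intro dvd_add) auto
  also have "A p q + 3 ^ nat w = (118 * p) * (p - 2 * q)"
    unfolding eq[symmetric] A_def by (simp add: algebra_simps power2_eq_square)
  finally have "3 ^ 5 dvd (118 * p) * (p - 2 * q)" .
  moreover have "\<not> 3 dvd 118 * p" using p(2) prime_dvd_multD[of "3::int" 118 p] by auto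
  then have "coprime (3 ^ 5) (118 * p)"
    by (rule coprime_three_power)
  ultimately have "3 ^ 5 dvd p - 2 * q"
    by (simp only: coprime_dvd_mult_right_iff)
  then obtain l where "p - 2 * q = 3 ^ 5 * l" ..
  then have l: "p = 3 ^ 5 * l + 2 * q" by simp
  have "A p q = 3 ^ 5 * (3 * (59 * 3 ^ 4 * l\<^sup>2) - q\<^sup>2)"
    unfolding A_def l by (simp add: algebra_simps power2_eq_square)
  with a have "a = 3 * (59 * 3 ^ 4 * l\<^sup>2) - q\<^sup>2" by simp
  moreover have "\<not> 3 dvd q\<^sup>2" using X(6) prime_dvd_power[of "3::int" q 2] by auto
  ultimately have "\<not> 3 dvd a" by (metis dvd_diff_right_iff dvd_triv_left)
  with ab w have "pp_solution (\<bar>a\<bar>, \<bar>b\<bar>, 2 * w - 5)" by (intro pp_solutionI) auto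
  moreover have e: "first_successor (q, p0, w) = (\<bar>a\<bar>, \<bar>b\<bar>, 2 * w - 5)"
    using a b by (simp add: first_successor_def p_def[symmetric] abs_mult)
  ultimately show "pp_solution (first_successor (q, p0, w))" by simp
  show "snd (snd (first_successor (q, p0, w))) = 2 * w - 5" using e by simp
qed

text \<open>
  With the opposite sign of \<open>p\<close> nothing cancels: \<open>p q \<equiv> -1\<close> and \<open>p\<^sup>2 \<equiv> q\<^sup>2 \<equiv> 1\<close> give
  \<open>A (- p) q \<equiv> -1 (mod 3)\<close>.
\<close>

lemma pp_solution_second_successor:
  assumes "pp_solution (q, p0, w)"
  shows "pp_solution (second_successor (q, p0, w))" "snd (snd (second_successor (q, p0, w))) = 2 * w + 5"
proof -
  note X = pp_solutionD[OF assms]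
  define p where "p = signed_root q p0"
  have p: "p\<^sup>2 = p0\<^sup>2" "(p * q) mod 3 = 2"
    using signed_rootD[OF assms] by (simp_all add: p_def)
  have eq: "7 * q\<^sup>2 + 59 * (- p)\<^sup>2 = 3 ^ nat w" using X p by simp
  have "(3::int) ^ nat (2 * w + 5) = 3 ^ 5 * (3 ^ nat w)\<^sup>2"
    using X(3)
    by (simp add: nat_add_distrib nat_mult_distrib power_add power_mult power2_eq_square power_mult_distrib[symmetric])
  then have ab: "7 * (A (- p) q)\<^sup>2 + 59 * (B (- p) q)\<^sup>2 = 3 ^ nat (2 * w + 5)"
    unfolding A_B_norm eq by simp
  have "3 dvd (3::int) ^ nat w" using X(3) by (intro dvd_power) auto
  then obtain c where "7 * q\<^sup>2 + 59 * p\<^sup>2 = 3 * c" using eq by auto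
  then have "A (- p) q = q\<^sup>2 - p * q + 3 * (c - 5 * q\<^sup>2 + 79 * (p * q))"
    unfolding A_def by (simp add: algebra_simps)
  then have "3 dvd A (- p) q \<longleftrightarrow> 3 dvd q\<^sup>2 - p * q"
    by (simp only: dvd_add_left_iff dvd_triv_left)
  moreover have "q\<^sup>2 mod 3 = 1"
  proof -
    have "q mod 3 = 1 \<or> q mod 3 = 2" using X(6) by presburger
    then show ?thesis by (auto simp: power_mod[of q 3 2, symmetric])
  qed
  moreover have "\<not> 3 dvd a - b" if "a mod 3 = 1" "b mod 3 = 2" for a b :: int
    using that by presburger
  ultimately have "\<not> 3 dvd A (- p) q" using p(2) by blast
  with ab X(3) have "pp_solution (\<bar>A (- p) q\<bar>, \<bar>B (- p) q\<bar>, 2 * w + 5)"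
    by (intro pp_solutionI) auto
  then show "pp_solution (second_successor (q, p0, w))" "snd (snd (second_successor (q, p0, w))) = 2 * w + 5"
    by (simp_all add: second_successor_def p_def[symmetric])
qed

lemma S_pp_solution:
  assumes "n \<ge> 1"
  shows "pp_solution (S n) \<and> snd (snd (S n)) = 10 * int n - 5 \<and> S n \<in> successor_tree"
  using assms
proof (induction n rule: less_induct)
  case (less n)
  consider "n = 1" | "n = 2" | m where "n = 2 * m - 1" "m \<ge> 2" | m where "n = 2 * m" "m \<ge> 2"
  proof -
    have "n = 2 * ((n + 1) div 2) - 1 \<or> n = 2 * (n div 2)" using less.prems by presburger
    moreover have "n = 1 \<or> n = 2 \<or> ((n + 1) div 2 \<ge> 2 \<and> n div 2 \<ge> 1 \<and> (even n \<longrightarrow> n div 2 \<ge> 2))"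
      using less.prems by presburger
    ultimately show ?thesis using that by (metis dvd_triv_left)
  qed
  then show ?case
  proof cases
    case 1
    then show ?thesis
      using successor_tree.root1 pp_solutionI[of 1 2 5] 1 by (simp add: S_1[simplified])
  next
    case 2
    have "\<not> (3::int) dvd 701" by presburger
    with 2 show ?thesis
      using successor_tree.root2 pp_solutionI[of 701 430 15] by (simp add: S_2)
  next
    case (3 m)
    then have "m < n" by linarith
    obtain q p w where m: "S m = (q, p, w)" by (metis prod_cases3)
    have "pp_solution (q, p, w)" "w = 10 * int m - 5" "S m \<in> successor_tree"
      using less.IH[OF \<open>m < n\<close>] 3(2) unfolding m by auto
    then show ?thesis
      using pp_solution_first_successor[of q p w] S_odd[OF 3(2)] successor_tree.first[of "S m"] 3 m
      by auto
  next
    case (4 m)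
    then have "m < n" by linarith
    obtain q p w where m: "S m = (q, p, w)" by (metis prod_cases3)
    have "pp_solution (q, p, w)" "w = 10 * int m - 5" "S m \<in> successor_tree"
      using less.IH[OF \<open>m < n\<close>] 4(2) unfolding m by auto
    then show ?thesis
      using pp_solution_second_successor[of q p w] S_even[OF 4(2)] successor_tree.second[of "S m"] 4 m
      by auto
  qed
qed

theorem theorem2:
  fixes t :: triple
  assumes "pp_solution t"
  shows "(\<exists>n\<ge>1. t = S n) \<and> t \<in> successor_tree"
proof -
  obtain x y m where t: "t = (x, y, m)" by (metis prod_cases3)
  obtain n where n: "n \<ge> 1" "m = 10 * int n - 5"
    using pp_solution_exponent assms unfolding t by blast
  note Sn = S_pp_solution[OF n(1)]
  obtain x' y' where S: "S n = (x', y', m)" using Sn n(2) by (metis prod.collapse)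
  have "t = S n" using pp_solution_unique[of x y m x' y'] assms Sn unfolding S t by simp
  with n(1) Sn show ?thesis by auto
qed

end
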